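(* Let $a,b\in\mathbb{C}$ with $|a|=|b|=1$, and let $H$ be either the $6\times 6$ complex Hadamard matrix $F(a,b)$ of the Fourier family or the $6\times 6$ complex Hadamard matrix $F^T(a,b)$ of the transposed Fourier family. Then $H$ cannot be extended to a full system of mutually unbiased complex Hadamard matrices in dimension $6$; that is, there do not exist $6\times 6$ complex Hadamard matrices $H_2,\dots,H_6$ such that the six matrices $H_1=H,H_2,\dots,H_6$ are pairwise unbiased.
   Context: An $n\times n$ complex Hadamard matrix is an $n\times n$ complex matrix all of whose entries have modulus $1$ and whose columns are pairwise orthogonal with respect to the standard Hermitian inner product on $\mathbb{C}^n$. Two $n\times n$ complex Hadamard matrices $H_1,H_2$ are called unbiased if $|\langle \mathbf u,\mathbf w\rangle|=\sqrt n$ for every column $\mathbf u$ of $H_1$ and every column $\mathbf w$ of $H_2$. A full system of mutually unbiased complex Hadamard matrices (MUHs) in dimension $n$ is a system of $n$ pairwise unbiased $n\times n$ complex Hadamard matrices. For unimodular $a,b$, let $\omega=e^{2\pi i/3}$ and $\mathbf f_0=(1,1,1)^T$, $\mathbf f_1=(1,\omega,\omega^{-1})^T$, $\mathbf f_2=(1,\omega^{-1},\omega)^T$. The matrix $F^T(a,b)$ (transposed Fourier family, up to permutation of rows and columns) is the $6\times 6$ matrix with columns, in block form, $$\begin{pmatrix}\mathbf f_0\\ \mathbf f_0\end{pmatrix},\ \begin{pmatrix}\mathbf f_0\\ -\mathbf f_0\end{pmatrix},\ \begin{pmatrix}\mathbf f_1\\ a\mathbf f_1\end{pmatrix},\ \begin{pmatrix}\mathbf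 f_1\\ -a\mathbf f_1\end{pmatrix},\ \begin{pmatrix}\mathbf f_2\\ b\mathbf f_2\end{pmatrix},\ \begin{pmatrix}\mathbf f_2\\ -b\mathbf f_2\end{pmatrix},$$ and $F(a,b)$ (Fourier family) is the transpose of this matrix. *)

theory Defs
  imports Complex_Main "Jordan_Normal_Form.Matrix"
begin

definition complex_hadamard :: "nat \<Rightarrow> complex mat \<Rightarrow> bool" where
  "complex_hadamard n H \<longleftrightarrow>
     H \<in> carrier_mat n n \<and>
     (\<forall>i<n. \<forall>j<n. cmod (H $$ (i, j)) = 1) \<and>
     (\<forall>j<n. \<forall>k<n. j \<noteq> k \<longrightarrow> col H j \<bullet>c col H k = 0)"

definition unbiased :: "nat \<Rightarrow> complex mat \<Rightarrow> complex mat \<Rightarrow> bool" where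
  "unbiased n H K \<longleftrightarrow>
     (\<forall>j<n. \<forall>k<n. cmod (col H j \<bullet>c col K k) = sqrt (real n))"

definition full_MUH_system :: "nat \<Rightarrow> complex mat list \<Rightarrow> bool" where
  "full_MUH_system n Hs \<longleftrightarrow>
     length Hs = n \<and>
     (\<forall>H \<in> set Hs. complex_hadamard n H) \<and>
     (\<forall>i<n. \<forall>j<n. i \<noteq> j \<longrightarrow> unbiased n (Hs ! i) (Hs ! j))"

definition omega :: complex where
  "omega = exp (2 * complex_of_real pi * \<i> / 3)"

definition f\<^sub>0 :: "complex vec" where "f\<^sub>0 = vec_of_list [1, 1, 1]"
definition f\<^sub>1 :: "complex vec" where "f\<^sub>1 = vec_of_list [1, omega, inverse omega]"
definition f\<^sub>2 :: "complex vec" where "f\<^sub>2 = vec_of_list [1, inverse omega, omega]"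

definition transposed_fourier_mat :: "complex \<Rightarrow> complex \<Rightarrow> complex mat" where
  "transposed_fourier_mat a b = mat_of_cols 6
     [f\<^sub>0 @\<^sub>v f\<^sub>0, f\<^sub>0 @\<^sub>v (- f\<^sub>0),
      f\<^sub>1 @\<^sub>v (a \<cdot>\<^sub>v f\<^sub>1), f\<^sub>1 @\<^sub>v ((- a) \<cdot>\<^sub>v f\<^sub>1),
      f\<^sub>2 @\<^sub>v (b \<cdot>\<^sub>v f\<^sub>2), f\<^sub>2 @\<^sub>v ((- b) \<cdot>\<^sub>v f\<^sub>2)]"

definition fourier_mat :: "complex \<Rightarrow> complex \<Rightarrow> complex mat" where
  "fourier_mat a b = transpose_mat (transposed_fourier_mat a b)"

lemma omega_eq: "omega = Complex (- 1 / 2) (sqrt 3 / 2)"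
proof -
  have "omega = cis (2 * pi / 3)"
    unfolding omega_def cis_conv_exp by (simp add: mult_ac)
  then show ?thesis
    by (simp add: complex_eq_iff cos_120 sin_120)
qed

lemma cmod_omega: "cmod omega = 1"
  by (simp add: omega_def)

lemma omega_sq: "omega * omega = - 1 - omega"
  by (simp add: omega_eq complex_eq_iff)

lemma cnj_omega: "cnj omega = - 1 - omega"
  by (simp add: omega_eq complex_eq_iff)

lemma inverse_omega: "inverse omega = - 1 - omega"
proof -
  have "omega * (- 1 - omega) = 1"
    by (simp add: right_diff_distrib omega_sq)
  then show ?thesis by (rule inverse_unique)
qed

lemma all_less_6: "(\<forall>i<6. P i) \<longleftrightarrow> P 0 \<and> P 1 \<and> P 2 \<and> P 3 \<and> P 4 \<and> P (5::nat)"
  by (simp add: eval_nat_numeral All_less_Suc conj_ac)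

definition fourier_entries :: "complex \<Rightarrow> complex \<Rightarrow> complex list list" where
  "fourier_entries a b = (let w = omega; v = inverse omega in
     [[1, 1, 1, 1, 1, 1], [1, 1, 1, -1, -1, -1],
      [1, w, v, a, a * w, a * v], [1, w, v, - a, - a * w, - a * v],
      [1, v, w, b, b * v, b * w], [1, v, w, - b, - b * v, - b * w]])"

lemma transposed_fourier_mat_index:
  "\<forall>i<6. \<forall>j<6. transposed_fourier_mat a b $$ (i, j) = fourier_entries a b ! j ! i"
  unfolding all_less_6
  by (simp add: transposed_fourier_mat_def mat_of_cols_def f\<^sub>0_def f\<^sub>1_def f\<^sub>2_def append_vec_def
      Let_def vec_of_list_index fourier_entries_def del: vec_of_list_Cons)

lemma transposed_fourier_mat_carrier: "transposed_fourier_mat a b \<in> carrier_mat 6 6"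
  by (simp add: transposed_fourier_mat_def mat_of_cols_def eval_nat_numeral)

lemma col_inner:
  assumes "H \<in> carrier_mat 6 6" "j < 6" "k < 6"
  shows "col H j \<bullet>c col H k = H $$ (0, j) * cnj (H $$ (0, k)) + H $$ (1, j) * cnj (H $$ (1, k))
    + H $$ (2, j) * cnj (H $$ (2, k)) + H $$ (3, j) * cnj (H $$ (3, k))
    + H $$ (4, j) * cnj (H $$ (4, k)) + H $$ (5, j) * cnj (H $$ (5, k))"
proof -
  have "col H j \<bullet>c col H k = (\<Sum>i<6. H $$ (i, j) * cnj (H $$ (i, k)))"
    using assms by (auto simp: scalar_prod_def atLeast0LessThan intro!: sum.cong)
  then show ?thesis by (simp add: eval_nat_numeral)
qed

lemma unimodular_cancel:
  assumes "cmod (a :: complex) = 1"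
  shows "a * cnj a = 1" "a * (cnj a * z) = z"
proof -
  show "a * cnj a = 1"
    using assms by (simp add: complex_norm_square[symmetric])
  then show "a * (cnj a * z) = z"
    by (simp add: mult.assoc[symmetric])
qed

lemma omega_sq': "omega * (omega * z) = (- 1 - omega) * z"
  by (simp add: omega_sq mult.assoc[symmetric])

text \<open>The two theorems below confirm that the matrices are complex Hadamard matrices,
  so that the question of extending them to a full system is not vacuous.\<close>

theorem complex_hadamard_transposed_fourier_mat:
  assumes "cmod a = 1" "cmod b = 1"
  shows "complex_hadamard 6 (transposed_fourier_mat a b)"
proof -
  let ?T = "transposed_fourier_mat a b"
  have e: "?T $$ (i, j) = fourier_entries a b ! j ! i" if "i < 6" "j < 6" for i j
    using transposed_fourier_mat_index that by blast
  have u: "\<forall>i<6. \<forall>j<6. cmod (?T $$ (i, j)) = 1"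
    unfolding all_less_6
    by (simp add: e) (simp add: fourier_entries_def Let_def norm_mult norm_inverse cmod_omega assms)
  have o: "\<forall>j<6. \<forall>k<6. j \<noteq> k \<longrightarrow> col ?T j \<bullet>c col ?T k = 0"
    unfolding all_less_6
    apply (simp add: col_inner[OF transposed_fourier_mat_carrier] e del: index_col)
    apply (simp add: fourier_entries_def Let_def inverse_omega cnj_omega)
    apply (simp add: algebra_simps omega_sq omega_sq' unimodular_cancel assms)
    done
  show ?thesis
    using u o transposed_fourier_mat_carrier by (simp add: complex_hadamard_def)
qed

theorem complex_hadamard_fourier_mat:
  assumes "cmod a = 1" "cmod b = 1"
  shows "complex_hadamard 6 (fourier_mat a b)"
proof -
  let ?F = "fourier_mat a b"
  have c: "?F \<in> carrier_mat 6 6"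
    by (simp add: fourier_mat_def transposed_fourier_mat_carrier)
  have e: "?F $$ (i, j) = fourier_entries a b ! i ! j" if "i < 6" "j < 6" for i j
    using transposed_fourier_mat_index that transposed_fourier_mat_carrier[of a b]
    by (simp add: fourier_mat_def)
  have u: "\<forall>i<6. \<forall>j<6. cmod (?F $$ (i, j)) = 1"
    unfolding all_less_6
    by (simp add: e) (simp add: fourier_entries_def Let_def norm_mult norm_inverse cmod_omega assms)
  have o: "\<forall>j<6. \<forall>k<6. j \<noteq> k \<longrightarrow> col ?F j \<bullet>c col ?F k = 0"
    unfolding all_less_6
    apply (simp add: col_inner[OF c] e del: index_col)
    apply (simp add: fourier_entries_def Let_def inverse_omega cnj_omega)
    apply (simp add: algebra_simps omega_sq omega_sq' unimodular_cancel assms)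
    done
  show ?thesis
    using u o c by (simp add: complex_hadamard_def)
qed

end

theory Submission
  imports Defs
begin

text \<open>The \<open>n\<^sup>2\<close> columns of a full system attain the minimal fourth moment, so
  every sum \<open>\<Sum> v\<^sub>a v\<^sub>b cnj (v\<^sub>c v\<^sub>d)\<close> over all of them with \<open>{a, b} \<noteq> {c, d}\<close> vanishes.
  Take \<open>H = F\<^sup>T(a, b)\<close> and attach to a column \<open>v\<close> the numbers
  \<open>s = v\<^sub>1/v\<^sub>0 + v\<^sub>2/v\<^sub>1 + v\<^sub>0/v\<^sub>2\<close> and \<open>t = v\<^sub>4/v\<^sub>3 + v\<^sub>5/v\<^sub>4 + v\<^sub>3/v\<^sub>5\<close>.
  Then \<open>|s|\<^sup>2\<close> sums to \<open>36 * 3 = 108\<close>, and the columns of \<open>H\<close> contribute \<open>6 * 9 = 54\<close>.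
  The cyclic shift in both halves is diagonal in the basis formed by the columns of \<open>H\<close> and has
  trace \<open>0\<close>, so unbiasedness to \<open>H\<close> forces \<open>s + t = 0\<close> for each of the other 30 columns.
  Since \<open>s\<close> and \<open>- s\<close> are then both sums of three unimodular numbers with product 1, both lie
  in a deltoid, which gives \<open>|s|\<^sup>4 + 18 |s|\<^sup>2 \<le> 27\<close> and hence \<open>|s|\<^sup>2 < 9/5\<close>: the 30 columns
  contribute less than 54, a contradiction. The case \<open>H = F(a, b)\<close> is dual: multiplying the
  system by the adjoint of \<open>H\<close>, divided by \<open>sqrt 6\<close>, turns the standard basis into the columns
  of the adjoint, which has the form \<open>F\<^sup>T\<close> up to complex conjugation.\<close>

section \<open>Unbiased families and passage to the dual family\<close>

definition inner_n :: "nat \<Rightarrow> (nat \<Rightarrow> complex) \<Rightarrow> (nat \<Rightarrow> complex) \<Rightarrow> complex" where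
  "inner_n n u v = (\<Sum>i<n. u i * cnj (v i))"

text \<open>In a family \<open>h\<close>, the number \<open>h m k i\<close> is the \<open>i\<close>-th entry of column \<open>k\<close> of the
  \<open>m\<close>-th matrix.\<close>

definition muh_family :: "nat \<Rightarrow> (nat \<Rightarrow> nat \<Rightarrow> nat \<Rightarrow> complex) \<Rightarrow> bool" where
  "muh_family n h \<longleftrightarrow>
     (\<forall>m<n. \<forall>k<n. \<forall>i<n. cmod (h m k i) = 1) \<and>
     (\<forall>m<n. \<forall>k<n. \<forall>l<n. k \<noteq> l \<longrightarrow> inner_n n (h m k) (h m l) = 0) \<and>
     (\<forall>m<n. \<forall>m'<n. m \<noteq> m' \<longrightarrow>
        (\<forall>k<n. \<forall>l<n. cmod (inner_n n (h m k) (h m' l)) = sqrt (real n)))"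

text \<open>With \<open>g k\<close> as column \<open>k\<close> of a matrix \<open>G\<close>, this is
  \<open>G G* = n I\<close>, the completeness relation behind Parseval's identity.\<close>

definition rows_orth :: "nat \<Rightarrow> (nat \<Rightarrow> nat \<Rightarrow> complex) \<Rightarrow> bool" where
  "rows_orth n g \<longleftrightarrow>
     (\<forall>i<n. \<forall>j<n. (\<Sum>k<n. g k i * cnj (g k j)) = (if i = j then of_nat n else 0))"

lemma cnj_inner_n: "cnj (inner_n n u v) = inner_n n v u"
  by (simp add: inner_n_def mult.commute)

lemma inner_n_self:
  assumes "\<And>i. i < n \<Longrightarrow> cmod (v i) = 1"
  shows "inner_n n v v = of_nat n"
  using assms by (simp add: inner_n_def unimodular_cancel)

lemma parseval:
  assumes "rows_orth n g"
  shows "(\<Sum>k<n. inner_n n u (g k) * cnj (inner_n n v (g k))) = of_nat n * inner_n n u v"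
proof -
  have "(\<Sum>k<n. inner_n n u (g k) * cnj (inner_n n v (g k))) =
      (\<Sum>k<n. \<Sum>a<n. \<Sum>b<n. u a * cnj (v b) * (g k b * cnj (g k a)))"
    by (simp add: inner_n_def sum_product mult_ac)
  also have "\<dots> = (\<Sum>a<n. \<Sum>k<n. \<Sum>b<n. u a * cnj (v b) * (g k b * cnj (g k a)))"
    by (rule sum.swap)
  also have "\<dots> = (\<Sum>a<n. \<Sum>b<n. \<Sum>k<n. u a * cnj (v b) * (g k b * cnj (g k a)))"
    by (intro sum.cong refl sum.swap)
  also have "\<dots> = (\<Sum>a<n. \<Sum>b<n. u a * cnj (v b) * (if b = a then of_nat n else 0))"
    using assms by (intro sum.cong refl) (simp add: rows_orth_def sum_distrib_left[symmetric])
  also have "\<dots> = of_nat n * inner_n n u v"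
    by (simp add: inner_n_def sum_distrib_left if_distrib mult_ac cong: if_cong)
  finally show ?thesis .
qed

text \<open>Let \<open>H\<close> be the matrix in slot 0. The unitary map \<open>H* / sqrt n\<close>
  preserves inner products, so relations among the other slots survive. Unbiasedness to
  \<open>H\<close> becomes unimodularity of the new entries, and unimodularity of the old entries
  becomes unbiasedness to \<open>H*\<close>, the rescaled image of the standard basis, which takes
  slot 0.\<close>

lemma muh_family_dual:
  assumes h: "muh_family n h" and r: "rows_orth n (h 0)" and n: "0 < n"
  shows "muh_family n (\<lambda>m k i. if m = 0 then cnj (h 0 i k)
           else inner_n n (h m k) (h 0 i) / complex_of_real (sqrt (real n)))"
    (is "muh_family n ?h")
proof -
  let ?q = "complex_of_real (sqrt (real n))"
  have q: "?q * ?q = of_nat n"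
    by (metis of_nat_0_le_iff of_real_mult of_real_of_nat_eq real_sqrt_mult_self abs_of_nonneg)
  have u: "cmod (h m k i) = 1" if "m < n" "k < n" "i < n" for m k i
    using h that by (simp add: muh_family_def)
  have o: "inner_n n (h m k) (h m l) = 0" if "m < n" "k < n" "l < n" "k \<noteq> l" for m k l
    using h that by (simp add: muh_family_def)
  have b: "cmod (inner_n n (h m k) (h m' l)) = sqrt (real n)"
    if "m < n" "m' < n" "m \<noteq> m'" "k < n" "l < n" for m m' k l
    using h that by (simp add: muh_family_def)
  have same: "inner_n n (?h m k) (?h m' l) = inner_n n (h m k) (h m' l)"
    if "m \<noteq> 0" "m' \<noteq> 0" for m m' k l
  proof -
    have "inner_n n (?h m k) (?h m' l) =
        (\<Sum>i<n. inner_n n (h m k) (h 0 i) * cnj (inner_n n (h m' l) (h 0 i))) / (?q * ?q)"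
      using that by (subst inner_n_def) (simp add: sum_divide_distrib)
    then show ?thesis
      using n by (simp only: parseval[OF r] q) simp
  qed
  have zero: "inner_n n (?h 0 k) (?h 0 l) = (if k = l then of_nat n else 0)"
    if "k < n" "l < n" for k l
    using r that by (auto simp: inner_n_def rows_orth_def mult.commute)
  have cross: "inner_n n (?h 0 k) (?h m l) = ?q * cnj (h m l k)"
    if "k < n" "m \<noteq> 0" for k m l
  proof -
    \<comment> \<open>A standard basis vector: its inner products with the columns
      \<open>h 0 i\<close> are the entries of the new column in slot 0, so Parseval applies to
      it.\<close>
    define e :: "nat \<Rightarrow> complex" where "e = (\<lambda>i. if i = k then 1 else 0)"
    have e: "inner_n n e v = cnj (v k)" for v
      using that by (simp add: inner_n_def e_def if_distrib if_distribR cong: if_cong)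
    have "inner_n n (?h 0 k) (?h m l) =
        (\<Sum>i<n. inner_n n e (h 0 i) * cnj (inner_n n (h m l) (h 0 i))) / ?q"
      using that by (subst inner_n_def) (simp add: sum_divide_distrib e)
    also have "\<dots> = ?q * ?q * cnj (h m l k) / ?q"
      by (simp only: parseval[OF r] q) (simp only: e)
    finally show ?thesis using n by simp
  qed
  have cross': "cmod (inner_n n (?h 0 k) (?h m l)) = sqrt (real n)"
    if "k < n" "l < n" "m < n" "m \<noteq> 0" for k m l
    using cross[of k m l] u[of m l k] that n by (simp add: norm_mult)
  have cross'': "cmod (inner_n n (?h m l) (?h 0 k)) = sqrt (real n)"
    if "k < n" "l < n" "m < n" "m \<noteq> 0" for k m l
    using cross'[OF that] by (subst cnj_inner_n[symmetric]) simp
  show ?thesis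
    unfolding muh_family_def
  proof (intro conjI allI impI)
    fix m k i assume "m < n" "k < n" "i < n"
    then show "cmod (?h m k i) = 1"
      using n u[of 0 i k] b[of m 0 k i] by (simp add: norm_divide)
  next
    fix m k l assume a: "m < n" "k < n" "l < n" "k \<noteq> l"
    show "inner_n n (?h m k) (?h m l) = 0"
    proof (cases "m = 0")
      case True then show ?thesis using zero a by simp
    next
      case False
      show ?thesis by (simp only: same[OF False False] o[OF a])
    qed
  next
    fix m m' k l assume a: "m < n" "m' < n" "m \<noteq> m'" "k < n" "l < n"
    consider "m = 0" | "m' = 0" | "m \<noteq> 0" "m' \<noteq> 0" by blast
    then show "cmod (inner_n n (?h m k) (?h m' l)) = sqrt (real n)"
    proof cases
      case 1
      then have "m' \<noteq> 0" using a by simp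
      from cross'[OF a(4,5,2) this] show ?thesis by (simp only: 1)
    next
      case 2
      then have "m \<noteq> 0" using a by simp
      from cross''[OF a(5,4,1) this] show ?thesis by (simp only: 2)
    next
      case 3
      show ?thesis by (simp only: same[OF 3] b[OF a])
    qed
  qed
qed

section \<open>Fourth moments and the vanishing of unpaired sums\<close>

text \<open>Both sides are the squared Frobenius norm of the sum of the rank-one operators given by
  the vectors \<open>v x\<close> tensored with themselves: entrywise on the left, through pairwise
  inner products on the right.\<close>

lemma fourth_moment:
  fixes v :: "'c \<Rightarrow> nat \<Rightarrow> complex"
  shows "(\<Sum>(a, b, c, d) \<in> {..<n} \<times> {..<n} \<times> {..<n} \<times> {..<n}.
      (cmod (\<Sum>x\<in>V. v x a * v x b * cnj (v x c) * cnj (v x d)))\<^sup>2) =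
    (\<Sum>x\<in>V. \<Sum>y\<in>V. cmod (inner_n n (v x) (v y)) ^ 4)"
proof -
  let ?N = "{..<n}"
  define w where "w x y a = v x a * cnj (v y a)" for x y a
  have sw: "(\<Sum>a\<in>A. \<Sum>x\<in>V. \<Sum>y\<in>V. f a x y) = (\<Sum>x\<in>V. \<Sum>y\<in>V. \<Sum>a\<in>A. f a x y)"
    for A :: "(nat \<times> nat \<times> nat \<times> nat) set" and f :: "_ \<Rightarrow> _ \<Rightarrow> _ \<Rightarrow> complex"
    by (subst sum.swap, rule sum.cong[OF refl], rule sum.swap)
  have "complex_of_real (\<Sum>(a, b, c, d) \<in> ?N \<times> ?N \<times> ?N \<times> ?N.
      (cmod (\<Sum>x\<in>V. v x a * v x b * cnj (v x c) * cnj (v x d)))\<^sup>2) =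
    (\<Sum>(a, b, c, d) \<in> ?N \<times> ?N \<times> ?N \<times> ?N. \<Sum>x\<in>V. \<Sum>y\<in>V.
      w x y a * w x y b * cnj (w x y c) * cnj (w x y d))"
    by (simp add: split_def complex_norm_square sum_product w_def mult_ac del: of_real_power)
  also have "\<dots> = (\<Sum>x\<in>V. \<Sum>y\<in>V. \<Sum>(a, b, c, d) \<in> ?N \<times> ?N \<times> ?N \<times> ?N.
      w x y a * w x y b * cnj (w x y c) * cnj (w x y d))"
    unfolding split_def by (rule sw)
  \<comment> \<open>The summand is a product of four factors in separate indices, so the fourfold
    sum factors.\<close>
  also have "\<dots> = (\<Sum>x\<in>V. \<Sum>y\<in>V. (\<Sum>a<n. w x y a)\<^sup>2 * (cnj (\<Sum>a<n. w x y a))\<^sup>2)"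
    by (intro sum.cong refl)
      (simp add: sum.cartesian_product[symmetric] power2_eq_square mult.assoc[symmetric]
        sum_distrib_left[symmetric] sum_distrib_right[symmetric])
  also have "\<dots> = complex_of_real (\<Sum>x\<in>V. \<Sum>y\<in>V. cmod (inner_n n (v x) (v y)) ^ 4)"
  proof -
    have "z\<^sup>2 * (cnj z)\<^sup>2 = complex_of_real (cmod z ^ 4)" for z
    proof -
      have "complex_of_real (cmod z ^ 4) = (complex_of_real ((cmod z)\<^sup>2))\<^sup>2"
        by (simp flip: power_mult)
      also have "\<dots> = z\<^sup>2 * (cnj z)\<^sup>2"
        by (simp only: complex_norm_square power_mult_distrib)
      finally show ?thesis by simp
    qed
    then show ?thesis by (simp only: inner_n_def w_def of_real_sum)
  qed
  finally show ?thesis by (simp only: of_real_eq_iff)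
qed

text \<open>Two sets of \<open>n^2\<close> quadruples overlap in the \<open>n\<close> constant ones.
  The additive form avoids subtraction on naturals.\<close>

lemma card_paired_indices:
  "card {(a, b, c, d) \<in> {..<n} \<times> {..<n} \<times> {..<n} \<times> {..<n}.
      (a = c \<and> b = d) \<or> (a = d \<and> b = c)} + n = 2 * n\<^sup>2"
proof -
  let ?A = "(\<lambda>(a, b). (a, b, a, b)) ` ({..<n} \<times> {..<n})"
  let ?B = "(\<lambda>(a, b). (a, b, b, a)) ` ({..<n} \<times> {..<n})"
  have U: "{(a, b, c, d) \<in> {..<n} \<times> {..<n} \<times> {..<n} \<times> {..<n}.
      (a = c \<and> b = d) \<or> (a = d \<and> b = c)} = ?A \<union> ?B"
    by auto
  have I: "?A \<inter> ?B = (\<lambda>a. (a, a, a, a)) ` {..<n}"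
    by auto
  have "card ?A = n\<^sup>2" "card ?B = n\<^sup>2"
    by (subst card_image, auto simp: inj_on_def power2_eq_square)+
  moreover have "card (?A \<inter> ?B) = n"
    unfolding I by (subst card_image) (auto simp: inj_on_def)
  ultimately show ?thesis
    using card_Un_Int[of ?A ?B] unfolding U by simp
qed

text \<open>Each of the \<open>n^2\<close> columns contributes \<open>n^4\<close> with itself, 0
  with the rest of its own matrix, and \<open>n^2\<close> with each of the \<open>n (n - 1)\<close>
  columns of the other matrices.\<close>

lemma muh_fourth_moment:
  assumes h: "muh_family n h"
  shows "(\<Sum>x\<in>{..<n} \<times> {..<n}. \<Sum>y\<in>{..<n} \<times> {..<n}.
      cmod (inner_n n (h (fst x) (snd x)) (h (fst y) (snd y))) ^ 4) =
    real n ^ 4 * (2 * (real n)\<^sup>2 - real n)"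
proof -
  have "(\<Sum>y\<in>{..<n} \<times> {..<n}. cmod (inner_n n (h (fst x) (snd x)) (h (fst y) (snd y))) ^ 4) =
      real n ^ 4 + (real n * (real n - 1)) * (real n)\<^sup>2" (is "?L = _")
    if x: "x \<in> {..<n} \<times> {..<n}" for x
  proof -
    obtain m k where mk: "x = (m, k)" "m < n" "k < n" using x by auto
    have "?L = (\<Sum>m'<n. \<Sum>l<n. cmod (inner_n n (h m k) (h m' l)) ^ 4)"
      by (simp add: mk sum.cartesian_product split_def)
    also have "\<dots> = (\<Sum>m'<n. if m' = m then real n ^ 4 else real n * (real n)\<^sup>2)"
    proof (rule sum.cong[OF refl])
      fix m' assume m': "m' \<in> {..<n}"
      show "(\<Sum>l<n. cmod (inner_n n (h m k) (h m' l)) ^ 4) =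
          (if m' = m then real n ^ 4 else real n * (real n)\<^sup>2)"
      proof (cases "m' = m")
        case True
        have "(\<Sum>l<n. cmod (inner_n n (h m k) (h m l)) ^ 4) =
            (\<Sum>l<n. if l = k then real n ^ 4 else 0)"
          using h mk inner_n_self[of n "h m k"]
          by (intro sum.cong refl) (auto simp: muh_family_def)
        then show ?thesis using True mk by simp
      next
        case False
        have "cmod (inner_n n (h m k) (h m' l)) ^ 4 = (real n)\<^sup>2" if "l < n" for l
        proof -
          have "cmod (inner_n n (h m k) (h m' l)) = sqrt (real n)"
            using h mk m' that False by (auto simp: muh_family_def)
          moreover have "sqrt (real n) ^ 4 = (sqrt (real n) ^ 2) ^ 2"
            by (simp only: power_mult[symmetric]) simp
          ultimately show ?thesis by simp
        qed
        then show ?thesis using False by simp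
      qed
    qed
    also have "\<dots> = real n ^ 4 + (real n - 1) * (real n * (real n)\<^sup>2)"
    proof -
      have "(\<Sum>m'\<in>{..<n} - {m}. if m' = m then real n ^ 4 else real n * (real n)\<^sup>2) =
          (\<Sum>m'\<in>{..<n} - {m}. real n * (real n)\<^sup>2)"
        by (intro sum.cong) auto
      then show ?thesis
        using mk by (simp add: sum.remove[of "{..<n}" m] of_nat_diff)
    qed
    finally show ?thesis by simp
  qed
  then have "(\<Sum>x\<in>{..<n} \<times> {..<n}. \<Sum>y\<in>{..<n} \<times> {..<n}.
      cmod (inner_n n (h (fst x) (snd x)) (h (fst y) (snd y))) ^ 4) =
    (\<Sum>x\<in>{..<n} \<times> {..<n}. real n ^ 4 + (real n * (real n - 1)) * (real n)\<^sup>2)"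
    by (rule sum.cong[OF refl])
  then show ?thesis
    by (simp add: power2_eq_square eval_nat_numeral algebra_simps)
qed

lemma muh_second_design:
  assumes h: "muh_family n h"
    and i: "a < n" "b < n" "c < n" "d < n"
    and ne: "\<not> ((a = c \<and> b = d) \<or> (a = d \<and> b = c))"
  shows "(\<Sum>m<n. \<Sum>k<n. h m k a * h m k b * cnj (h m k c) * cnj (h m k d)) = 0"
proof -
  define v where "v x = h (fst x) (snd x)" for x
  define V where "V = {..<n} \<times> {..<n}"
  define Q where "Q = {..<n} \<times> {..<n} \<times> {..<n} \<times> {..<n}"
  define P where "P = {(a, b, c, d) \<in> Q. (a = c \<and> b = d) \<or> (a = d \<and> b = c)}"
  define S where "S = (\<lambda>(a, b, c, d). (cmod (\<Sum>x\<in>V. v x a * v x b * cnj (v x c) * cnj (v x d)))\<^sup>2)"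
  \<comment> \<open>The paired quadruples alone account for the whole fourth moment.\<close>
  have P: "P \<subseteq> Q" "finite Q" by (auto simp: P_def Q_def)
  have un: "z * cnj z = 1" if "cmod z = 1" for z :: complex
    using that by (rule unimodular_cancel)
  have "S q = real n ^ 4" if "q \<in> P" for q
  proof -
    have "(\<Sum>x\<in>V. v x a * v x b * cnj (v x c) * cnj (v x d)) = of_nat (n * n)"
      if "q = (a, b, c, d)" for a b c d
    proof -
      have "v x a * v x b * cnj (v x c) * cnj (v x d) = 1" if x: "x \<in> V" for x
      proof -
        have 1: "v x a * cnj (v x a) = 1" "v x b * cnj (v x b) = 1"
          using h x \<open>q = (a, b, c, d)\<close> \<open>q \<in> P\<close>
          by (auto simp: v_def V_def P_def Q_def muh_family_def intro!: un)
        have "v x a * v x b * cnj (v x c) * cnj (v x d) =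
            (v x a * cnj (v x a)) * (v x b * cnj (v x b))"
          using \<open>q = (a, b, c, d)\<close> \<open>q \<in> P\<close> by (auto simp: P_def)
        then show ?thesis by (simp add: 1)
      qed
      then show ?thesis by (simp add: V_def)
    qed
    then show ?thesis
      by (cases q) (simp add: S_def norm_mult power2_eq_square eval_nat_numeral)
  qed
  then have SP: "sum S P = real (card P) * real n ^ 4" by simp
  have "real (card P) = 2 * (real n)\<^sup>2 - real n"
    using card_paired_indices[of n, folded Q_def, folded P_def]
    by (metis add_diff_cancel_right' of_nat_add of_nat_mult of_nat_numeral of_nat_power)
  moreover have "sum S Q = real n ^ 4 * (2 * (real n)\<^sup>2 - real n)"
    using muh_fourth_moment[OF h] fourth_moment[of v V n]
    by (simp add: S_def Q_def v_def V_def)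
  ultimately have "sum S (Q - P) = 0"
    using SP P by (simp add: sum_diff)
  \<comment> \<open>Nonnegative terms with sum 0 vanish one by one.\<close>
  moreover have "S q \<ge> 0" for q by (cases q) (simp add: S_def)
  ultimately have "\<forall>q\<in>Q - P. S q = 0"
    using P by (subst (asm) sum_nonneg_eq_0_iff) auto
  moreover have "(a, b, c, d) \<in> Q - P"
    using i ne by (auto simp: Q_def P_def)
  ultimately have "S (a, b, c, d) = 0" by blast
  then show ?thesis
    by (simp add: S_def v_def V_def sum.cartesian_product split_def)
qed

section \<open>Unbiasedness to an eigenbasis of a permutation\<close>

text \<open>The sum is the quadratic form of the permutation at \<open>v\<close>. In the eigenbasis
  \<open>g\<close> it is a combination of the eigenvalues \<open>l k\<close> with weights
  \<open>|<v, g k>|^2 / n\<close>; unbiasedness makes every weight 1, leaving the trace.\<close>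

lemma unbiased_eigen_shift:
  assumes r: "rows_orth n g"
    and s: "\<And>i. i < n \<Longrightarrow> \<sigma> i < n" and n: "0 < n" and s0: "\<sigma> 0 \<noteq> 0"
    and g: "\<And>k i. k < n \<Longrightarrow> i < n \<Longrightarrow> g k (\<sigma> i) = l k * g k i"
    and un: "\<And>k. k < n \<Longrightarrow> cmod (g k 0) = 1"
    and b: "\<And>k. k < n \<Longrightarrow> cmod (inner_n n v (g k)) = sqrt (real n)"
  shows "(\<Sum>i<n. v (\<sigma> i) * cnj (v i)) = 0"
proof -
  have "l k * (inner_n n v (g k) * cnj (inner_n n v (g k))) = l k * of_nat n" if "k < n" for k
  proof -
    have "inner_n n v (g k) * cnj (inner_n n v (g k)) = of_real ((cmod (inner_n n v (g k)))\<^sup>2)"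
      by (simp only: complex_norm_square)
    then show ?thesis using b[OF that] by simp
  qed
  then have "(\<Sum>k<n. l k * (inner_n n v (g k) * cnj (inner_n n v (g k)))) = (\<Sum>k<n. l k * of_nat n)"
    by (intro sum.cong) auto
  also have "\<dots> = (\<Sum>k<n. l k) * of_nat n"
    by (rule sum_distrib_right[symmetric])
  \<comment> \<open>Since \<open>g k 0\<close> is unimodular, the eigenvalue sum is the inner
    product of the distinct rows \<open>\<sigma> 0\<close> and 0.\<close>
  also have "(\<Sum>k<n. l k) = (\<Sum>k<n. g k (\<sigma> 0) * cnj (g k 0))"
    using g un n by (intro sum.cong refl) (simp add: unimodular_cancel mult.assoc)
  also have "\<dots> = 0"
    using r s n s0 by (simp add: rows_orth_def)
  finally have z: "(\<Sum>k<n. l k * (inner_n n v (g k) * cnj (inner_n n v (g k)))) = 0"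
    by simp
  \<comment> \<open>Second evaluation of the same sum: \<open>l k\<close> is absorbed by turning
    \<open>g k b\<close> into \<open>g k (\<sigma> b)\<close>.\<close>
  have "(\<Sum>k<n. l k * (inner_n n v (g k) * cnj (inner_n n v (g k)))) =
      (\<Sum>k<n. \<Sum>a<n. \<Sum>b<n. v a * cnj (v b) * (g k (\<sigma> b) * cnj (g k a)))"
    by (simp only: inner_n_def cnj_sum sum_product, simp only: sum_distrib_left)
      (intro sum.cong refl, simp add: g mult_ac)
  also have "\<dots> = (\<Sum>a<n. \<Sum>k<n. \<Sum>b<n. v a * cnj (v b) * (g k (\<sigma> b) * cnj (g k a)))"
    by (rule sum.swap)
  also have "\<dots> = (\<Sum>a<n. \<Sum>b<n. \<Sum>k<n. v a * cnj (v b) * (g k (\<sigma> b) * cnj (g k a)))"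
    by (intro sum.cong refl sum.swap)
  also have "\<dots> = (\<Sum>a<n. \<Sum>b<n. v a * cnj (v b) * (if \<sigma> b = a then of_nat n else 0))"
    using r s by (intro sum.cong refl) (simp add: rows_orth_def sum_distrib_left[symmetric])
  also have "\<dots> = (\<Sum>b<n. \<Sum>a<n. v a * cnj (v b) * (if \<sigma> b = a then of_nat n else 0))"
    by (rule sum.swap)
  also have "\<dots> = of_nat n * (\<Sum>b<n. v (\<sigma> b) * cnj (v b))"
    using s by (simp add: sum_distrib_left if_distrib mult_ac cong: if_cong)
  finally show ?thesis using z n by simp
qed

section \<open>The deltoid inequality\<close>

lemma deltoid_bound:
  fixes p q r :: complex
  assumes u: "cmod p = 1" "cmod q = 1" "cmod r = 1" and pqr: "p * q * r = 1"
  defines "s \<equiv> p + q + r"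
  shows "cmod s ^ 4 + 18 * (cmod s)\<^sup>2 - 8 * Re (s ^ 3) \<le> 27"
proof -
  \<comment> \<open>\<open>V\<^sup>2\<close> is the discriminant of \<open>x\<^sup>3 - s x\<^sup>2 + cnj s x - 1\<close>, the cubic with roots \<open>p, q, r\<close>,
    and \<open>cnj V = - V\<close>, so the discriminant is a nonpositive real number.\<close>
  define V where "V = (p - q) * (q - r) * (r - p)"
  have c: "cnj p = q * r" "cnj q = p * r" "cnj r = p * q"
  proof -
    have "cnj p * (p * q * r) = q * r" "cnj q * (p * q * r) = p * r" "cnj r * (p * q * r) = p * q"
      using u by (simp_all add: unimodular_cancel mult_ac)
    then show "cnj p = q * r" "cnj q = p * r" "cnj r = p * q"
      by (simp_all add: pqr)
  qed
  define t where "t = q * r + p * r + p * q"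
  have ct: "cnj s = t" by (simp add: s_def t_def c)
  have V: "V * cnj V = 27 - (s * t)\<^sup>2 - 18 * (s * t) + 4 * s ^ 3 + 4 * t ^ 3"
  proof -
    \<comment> \<open>Conjugation gives \<open>q * r - p * r = - r * (p - q)\<close> and its cyclic
      analogues.\<close>
    have "V * cnj V = - (p * q * r) * V\<^sup>2"
      unfolding V_def complex_cnj_mult complex_cnj_diff c
      by (simp add: algebra_simps power2_eq_square)
    \<comment> \<open>The cubic discriminant in elementary symmetric functions, homogenized by
      \<open>p * q * r\<close> so that it is a polynomial identity.\<close>
    also have "V\<^sup>2 = (s * t)\<^sup>2 - 4 * t ^ 3 - 4 * s ^ 3 * (p * q * r)
        + 18 * (s * t) * (p * q * r) - 27 * (p * q * r)\<^sup>2"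
      unfolding V_def s_def t_def
      by (simp add: algebra_simps power2_eq_square power3_eq_cube)
    finally show ?thesis by (simp add: pqr)
  qed
  have s3: "s ^ 3 + t ^ 3 = complex_of_real (2 * Re (s ^ 3))"
    by (metis complex_add_cnj complex_cnj_power ct)
  have st: "s * t = complex_of_real ((cmod s)\<^sup>2)"
    unfolding ct[symmetric] by (rule complex_norm_square[symmetric])
  have "complex_of_real ((cmod V)\<^sup>2) =
      27 - (s * t)\<^sup>2 - 18 * (s * t) + 4 * (s ^ 3 + t ^ 3)"
    by (simp only: complex_norm_square V) (simp add: distrib_left)
  also have "\<dots> = complex_of_real (27 - ((cmod s)\<^sup>2)\<^sup>2 - 18 * (cmod s)\<^sup>2 + 4 * (2 * Re (s ^ 3)))"
    by (simp only: s3 st) simp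
  finally have "(cmod V)\<^sup>2 = 27 - ((cmod s)\<^sup>2)\<^sup>2 - 18 * (cmod s)\<^sup>2 + 4 * (2 * Re (s ^ 3))"
    by (simp only: of_real_eq_iff)
  moreover have "((cmod s)\<^sup>2)\<^sup>2 = cmod s ^ 4" by (simp flip: power_mult)
  ultimately show ?thesis using zero_le_power2[of "cmod V"] by linarith
qed

text \<open>The deltoid inequalities for \<open>s\<close> and \<open>- s\<close> have opposite cubic
  terms, so adding them leaves a quadratic inequality in \<open>|s|^2\<close>. The constant is
  \<open>54 / 30\<close>, the average that the final count has to beat.\<close>

lemma opposite_triples_bound:
  fixes p q r p' q' r' :: complex
  assumes "cmod p = 1" "cmod q = 1" "cmod r = 1" "p * q * r = 1"
    and "cmod p' = 1" "cmod q' = 1" "cmod r' = 1" "p' * q' * r' = 1"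
    and z: "(p + q + r) + (p' + q' + r') = 0"
  shows "(cmod (p + q + r))\<^sup>2 < 9 / 5"
proof -
  define s where "s = p + q + r"
  have s': "p' + q' + r' = - s" using z by (simp add: s_def add_eq_0_iff)
  have "cmod s ^ 4 + 18 * (cmod s)\<^sup>2 - 8 * Re (s ^ 3) \<le> 27"
    using deltoid_bound[OF assms(1-4)] by (simp add: s_def)
  moreover have "cmod s ^ 4 + 18 * (cmod s)\<^sup>2 + 8 * Re (s ^ 3) \<le> 27"
    using deltoid_bound[OF assms(5-8)] by (simp add: s')
  ultimately have "((cmod s)\<^sup>2)\<^sup>2 + 18 * (cmod s)\<^sup>2 \<le> 27" 
    by (simp flip: power_mult)
  \<comment> \<open>At \<open>9/5\<close> the quadratic is already
    \<open>35.64 > 27\<close>.\<close>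
  moreover have "(9/5)\<^sup>2 \<le> ((cmod s)\<^sup>2)\<^sup>2" if "9 / 5 \<le> (cmod s)\<^sup>2"
    using that by (intro power_mono) auto
  ultimately show ?thesis
    unfolding s_def[symmetric] by (force simp: power2_eq_square)
qed

section \<open>The counting contradiction in dimension 6\<close>

definition shift3 :: "nat \<Rightarrow> nat" where
  "shift3 i = (if i mod 3 = 2 then i - 2 else i + 1)"

lemma shift3_simps:
  "shift3 0 = 1" "shift3 1 = 2" "shift3 (Suc 0) = 2" "shift3 2 = 0" "shift3 3 = 4" "shift3 4 = 5" "shift3 5 = 3"
  by (simp_all add: shift3_def)

lemma shift3_less_6: "i < 6 \<Longrightarrow> shift3 i < 6"
proof -
  have "\<forall>i<6. shift3 i < 6"
    unfolding all_less_6 shift3_simps by simp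
  then show "i < 6 \<Longrightarrow> shift3 i < 6" by blast
qed

lemma sum_less_6: "(\<Sum>i<6. f i) = f 0 + f 1 + f 2 + f 3 + f 4 + f (5::nat)"
  for f :: "nat \<Rightarrow> 'a::comm_monoid_add"
  by (simp add: eval_nat_numeral)

text \<open>Slot 0 enters through row orthogonality and the eigenvector relation, so this covers
  both \<open>F^T\<close> and the dual of \<open>F\<close>.\<close>

lemma no_muh_family_shift:
  assumes h: "muh_family 6 h" and r: "rows_orth 6 (h 0)"
    and e: "\<And>k i. k < 6 \<Longrightarrow> i < 6 \<Longrightarrow> h 0 k (shift3 i) = l k * h 0 k i"
  shows False
proof -
  \<comment> \<open>For unimodular entries this is the ratio of cyclically adjacent entries.\<close>
  define p where "p m k i = h m k (shift3 i) * cnj (h m k i)" for m k i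
  define s where "s m k = p m k 0 + p m k 1 + p m k 2" for m k
  note sh = shift3_less_6
  have u: "cmod (h m k i) = 1" if "m < 6" "k < 6" "i < 6" for m k i
    using h that by (simp add: muh_family_def)
  have pu: "cmod (p m k i) = 1" if "m < 6" "k < 6" "i < 6" for m k i
    using that sh by (simp add: p_def norm_mult u)
  \<comment> \<open>The ratios telescope around each 3-cycle.\<close>
  have pp: "p m k 0 * p m k 1 * p m k 2 = 1" "p m k 3 * p m k 4 * p m k 5 = 1"
    if "m < 6" "k < 6" for m k
    using u that by (simp_all add: p_def shift3_simps unimodular_cancel mult_ac)
  have small: "(cmod (s m k))\<^sup>2 < 9 / 5" if "m < 6" "k < 6" "m \<noteq> 0" for m k
  proof -
    have "(\<Sum>i<6. h m k (shift3 i) * cnj (h m k i)) = 0"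
    proof (rule unbiased_eigen_shift[OF r, where l = l])
      show "cmod (inner_n 6 (h m k) (h 0 ka)) = sqrt (real 6)" if "ka < 6" for ka
        using h that \<open>m < 6\<close> \<open>k < 6\<close> \<open>m \<noteq> 0\<close> by (simp add: muh_family_def)
    qed (use sh e u in \<open>auto simp: shift3_simps\<close>)
    then have "(p m k 0 + p m k 1 + p m k 2) + (p m k 3 + p m k 4 + p m k 5) = 0"
      by (simp add: sum_less_6 p_def[symmetric] add_ac)
    then show ?thesis
      unfolding s_def using that 
      by (intro opposite_triples_bound[where p' = "p m k 3" and q' = "p m k 4" and r' = "p m k 5"]
          pu pp) auto
  qed
  have big: "(cmod (s 0 k))\<^sup>2 = 9" if "k < 6" for k
  proof -
    have "p 0 k i = l k" if "i < 6" for i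
      using e[OF \<open>k < 6\<close> that] u[of 0 k i] \<open>k < 6\<close> that
      by (simp add: p_def mult.assoc unimodular_cancel)
    moreover from this[of 0] have "cmod (l k) = 1" using pu[of 0 k 0] that by simp
    ultimately have "s 0 k = 3 * l k" "cmod (l k) = 1" by (simp_all add: s_def)
    then show ?thesis by (simp add: norm_mult)
  qed
  have orth: "(\<Sum>m<6. \<Sum>k<6. p m k i * cnj (p m k j)) = (if i = j then 36 else 0)"
    if "i < 3" "j < 3" for i j
  proof (cases "i = j")
    case True
    have "p m k i * cnj (p m k i) = 1" if "m < 6" "k < 6" for m k
      using pu[OF that, of i] \<open>i < 3\<close> by (intro unimodular_cancel) auto
    then show ?thesis using True by simp
  next
    case False
    \<comment> \<open>\<open>shift3\<close> has no fixed point, so the index pairs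
      \<open>{shift3 i, j}\<close> and \<open>{i, shift3 j}\<close> differ and the design property
      applies.\<close>
    have "\<not> ((shift3 i = i \<and> j = shift3 j) \<or> (shift3 i = shift3 j \<and> j = i))"
      using that False by (auto simp: shift3_def)
    from muh_second_design[OF h _ _ _ _ this] that sh False
    show ?thesis by (simp add: p_def mult_ac)
  qed
  have s_sum: "s m k = (\<Sum>i<3. p m k i)" for m k
    by (simp add: s_def eval_nat_numeral)
  have sw: "(\<Sum>k<6. \<Sum>i<3. \<Sum>j<3. f k i j) = (\<Sum>i<3. \<Sum>j<3. \<Sum>k<6. f k i j)"
    for f :: "nat \<Rightarrow> nat \<Rightarrow> nat \<Rightarrow> complex"
    by (subst sum.swap) (intro sum.cong refl sum.swap)
  have "complex_of_real (\<Sum>m<6. \<Sum>k<6. (cmod (s m k))\<^sup>2) =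
      (\<Sum>m<6. \<Sum>k<6. \<Sum>i<3. \<Sum>j<3. p m k i * cnj (p m k j))"
    by (simp only: of_real_sum complex_norm_square s_sum cnj_sum sum_product)
  also have "\<dots> = (\<Sum>m<6. \<Sum>i<3. \<Sum>j<3. \<Sum>k<6. p m k i * cnj (p m k j))"
    by (intro sum.cong refl sw)
  also have "\<dots> = (\<Sum>i<3. \<Sum>j<3. \<Sum>m<6. \<Sum>k<6. p m k i * cnj (p m k j))"
    by (rule sw)
  also have "\<dots> = (\<Sum>i<3::nat. \<Sum>j<3::nat. if i = j then 36 else (0::complex))"
    using orth by (intro sum.cong refl) auto
  also have "\<dots> = complex_of_real 108" by simp
  finally have tot: "(\<Sum>m<6. \<Sum>k<6. (cmod (s m k))\<^sup>2) = 108"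
    by (simp only: of_real_eq_iff)
  \<comment> \<open>\<open>54 / 5\<close> is \<open>6 * (9 / 5)\<close>; five such matrices stay
    below 54.\<close>
  have lt: "(\<Sum>k<6. (cmod (s m k))\<^sup>2) < 54 / 5" if "m < 6" "m \<noteq> 0" for m
  proof -
    have "(\<Sum>k<6. (cmod (s m k))\<^sup>2) < (\<Sum>k<6::nat. 9 / 5)"
      using small[OF that(1) _ that(2)] by (intro sum_strict_mono) (auto simp: lessThan_empty_iff)
    then show ?thesis by simp
  qed
  have "(\<Sum>k<6. (cmod (s 0 k))\<^sup>2) = 54" using big by simp
  with tot lt[of 1] lt[of 2] lt[of 3] lt[of 4] lt[of 5] show False
    unfolding sum_less_6[of "\<lambda>m. \<Sum>k<6. (cmod (s m k))\<^sup>2"] by simp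
qed

section \<open>From matrices to families, and the two Fourier cases\<close>

lemma col_inner_n:
  assumes "A \<in> carrier_mat n n" "B \<in> carrier_mat n n" "j < n" "k < n"
  shows "col A j \<bullet>c col B k = inner_n n (\<lambda>i. A $$ (i, j)) (\<lambda>i. B $$ (i, k))"
  using assms by (auto simp: inner_n_def scalar_prod_def atLeast0LessThan intro!: sum.cong)

lemma full_MUH_system_family:
  assumes "full_MUH_system n Hs"
  shows "muh_family n (\<lambda>m k i. (Hs ! m) $$ (i, k))"
proof -
  have H: "complex_hadamard n (Hs ! m)" if "m < n" for m
    using assms that by (simp add: full_MUH_system_def)
  then have C: "Hs ! m \<in> carrier_mat n n" if "m < n" for m
    using that by (simp add: complex_hadamard_def)
  show ?thesis
    unfolding muh_family_def
  proof (intro conjI allI impI)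
    fix m k i assume "m < n" "k < n" "i < n"
    then show "cmod ((Hs ! m) $$ (i, k)) = 1"
      using H by (simp add: complex_hadamard_def)
  next
    fix m k l assume "m < n" "k < n" "l < n" "k \<noteq> l"
    then show "inner_n n (\<lambda>i. (Hs ! m) $$ (i, k)) (\<lambda>i. (Hs ! m) $$ (i, l)) = 0"
      using H[of m] by (subst col_inner_n[symmetric]) (auto simp: complex_hadamard_def C)
  next
    fix m m' k l assume "m < n" "m' < n" "m \<noteq> m'" "k < n" "l < n"
    then show "cmod (inner_n n (\<lambda>i. (Hs ! m) $$ (i, k)) (\<lambda>i. (Hs ! m') $$ (i, l))) = sqrt (real n)"
      using assms
      by (subst col_inner_n[symmetric]) (auto simp: full_MUH_system_def unbiased_def C)
  qed
qed

lemma hadamard_transpose_rows_orth: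
  assumes "complex_hadamard n (transpose_mat A)" "A \<in> carrier_mat n n"
  shows "rows_orth n (\<lambda>k i. A $$ (i, k))"
  unfolding rows_orth_def
proof (intro allI impI)
  fix i j assume ij: "i < n" "j < n"
  have "(\<Sum>k<n. A $$ (i, k) * cnj (A $$ (j, k))) = col (transpose_mat A) i \<bullet>c col (transpose_mat A) j"
    using ij assms(2) by (subst col_inner_n[of _ n]) (auto simp: inner_n_def)
  also have "\<dots> = (if i = j then of_nat n else 0)"
  proof (cases "i = j")
    case True
    have "cmod (A $$ (i, k)) = 1" if "k < n" for k
      using assms ij that by (auto simp: complex_hadamard_def)
    then show ?thesis
      using ij assms(2) True
      by (subst col_inner_n[of _ n]) (auto simp: inner_n_def unimodular_cancel)
  qed (use assms(1) ij in \<open>simp add: complex_hadamard_def\<close>)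
  finally show "(\<Sum>k<n. A $$ (i, k) * cnj (A $$ (j, k))) = (if i = j then of_nat n else 0)" .
qed

text \<open>\<open>f\<^sub>0\<close>, \<open>f\<^sub>1\<close>, \<open>f\<^sub>2\<close> are
  eigenvectors of the cyclic shift with eigenvalues 1, \<open>omega\<close>,
  \<open>inverse omega\<close>; scaling the lower half by a constant preserves this, as
  \<open>shift3\<close> keeps the halves apart.\<close>

lemma transposed_fourier_mat_shift:
  assumes "k < 6" "i < 6"
  shows "transposed_fourier_mat a b $$ (shift3 i, k) =
    [1, 1, omega, omega, inverse omega, inverse omega] ! k * transposed_fourier_mat a b $$ (i, k)"
proof -
  have e: "transposed_fourier_mat a b $$ (i, j) = fourier_entries a b ! j ! i"
    if "i < 6" "j < 6" for i j
    using transposed_fourier_mat_index that by blast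
  have "\<forall>i<6. \<forall>k<6. transposed_fourier_mat a b $$ (shift3 i, k) =
    [1, 1, omega, omega, inverse omega, inverse omega] ! k * transposed_fourier_mat a b $$ (i, k)"
    unfolding all_less_6 shift3_simps
    by (simp add: e) (simp add: fourier_entries_def Let_def inverse_omega algebra_simps omega_sq omega_sq')
  then show ?thesis using assms by blast
qed

theorem theorem4p1:
  fixes a b :: complex and H :: "complex mat"
  assumes "cmod a = 1" and "cmod b = 1"
    and "H = fourier_mat a b \<or> H = transposed_fourier_mat a b"
  shows "\<not> (\<exists>H\<^sub>2 H\<^sub>3 H\<^sub>4 H\<^sub>5 H\<^sub>6. full_MUH_system 6 [H, H\<^sub>2, H\<^sub>3, H\<^sub>4, H\<^sub>5, H\<^sub>6])"
proof
  let ?T = "transposed_fourier_mat a b" and ?F = "fourier_mat a b"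
  let ?l = "\<lambda>k. [1, 1, omega, omega, inverse omega, inverse omega] ! k"
  assume "\<exists>H\<^sub>2 H\<^sub>3 H\<^sub>4 H\<^sub>5 H\<^sub>6. full_MUH_system 6 [H, H\<^sub>2, H\<^sub>3, H\<^sub>4, H\<^sub>5, H\<^sub>6]"
  then obtain Hs where "full_MUH_system 6 (H # Hs)" by blast
  note M = full_MUH_system_family[OF this]
  have T: "complex_hadamard 6 ?T" and F: "complex_hadamard 6 ?F"
    using assms by (auto intro: complex_hadamard_transposed_fourier_mat complex_hadamard_fourier_mat)
  have tr: "transpose_mat ?F = ?T" "transpose_mat ?T = ?F"
    by (simp_all add: fourier_mat_def)
  have car: "?T \<in> carrier_mat 6 6" "?F \<in> carrier_mat 6 6"
    using T F by (simp_all add: complex_hadamard_def)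
  have rT: "rows_orth 6 (\<lambda>k i. ?T $$ (i, k))" and rF: "rows_orth 6 (\<lambda>k i. ?F $$ (i, k))"
    by (rule hadamard_transpose_rows_orth; simp add: tr T F car)+
  have FT: "?F $$ (k, i) = ?T $$ (i, k)" if "i < 6" "k < 6" for i k
    using that car by (simp add: fourier_mat_def)
  from assms(3) show False
  proof
    assume H: "H = ?T"
    show False
      by (rule no_muh_family_shift[OF M, where l = ?l])
        (simp_all add: H rT transposed_fourier_mat_shift)
  next
    assume H: "H = ?F"
    have "rows_orth 6 (\<lambda>k i. ((H # Hs) ! 0) $$ (i, k))" by (simp add: H rF)
    note D = muh_family_dual[OF M this]
    show False
    \<comment> \<open>Slot 0 of the dual family is the entrywise conjugate of \<open>?T\<close>,
      hence the conjugated eigenvalues.\<close>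
    proof (rule no_muh_family_shift[OF D, where l = "\<lambda>k. cnj (?l k)"])
      have "(\<Sum>k<6. cnj (?T $$ (i, k)) * ?T $$ (j, k)) =
          (if i = j then of_nat 6 else 0)" if "i < 6" "j < 6" for i j
        using rT that by (auto simp: rows_orth_def mult.commute)
      then show "rows_orth 6 (\<lambda>k i. if (0::nat) = 0 then cnj (((H # Hs) ! 0) $$ (k, i))
           else inner_n 6 (\<lambda>ia. ((H # Hs) ! 0) $$ (ia, k)) (\<lambda>ia. ((H # Hs) ! 0) $$ (ia, i)) / complex_of_real (sqrt (real 6)))"
        by (simp add: rows_orth_def H FT)
    qed (simp_all add: H FT shift3_less_6 transposed_fourier_mat_shift del: nth_Cons_numeral)
  qed
qed

end
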